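(* Let $p\ge 1$ players divide $m\ge 1$ cakes, each cake cut into $k$ pieces, and suppose $k\geq 1+(p-1)/m$. Suppose each player $j\in\{1,\dots,p\}$ has a preference correspondence $\mathrm{Pref}_j$ satisfying the assumptions (hungry players and closed preference sets) described in the context. Then there exist a division $x$ and piece selections $s_1,\dots,s_p$ that are pairwise different (for $j\ne j'$, $s_j(i)\neq s_{j'}(i)$ for at least one cake $i$, though they need not be disjoint) such that $s_j\in \mathrm{Pref}_j(x)$ for every player $j$.
   Context: Model of multi-cake division. There are $m$ cakes, each of length $1$, and cake $i$ is cut into $k$ pieces. A division is an $m\times k$ matrix $x=(x_{ij})$ with $x_{ij}\ge 0$ and $\sum_{j=1}^k x_{ij}=1$ for every $i$; $x_{ij}$ is the length of the $j$-th piece of the $i$-th cake. A piece selection is a choice of one piece from each cake, i.e. a map $s:\{1,\dots,m\}\to\{1,\dots,k\}$. Two piece selections are different if they differ on at least one cake, and disjoint if $s(i)\ne s'(i)$ for every cake $i$. Each player's preferences are given by assigning to every division $x$ a nonempty set $\mathrm{Pref}(x)$ of piece selections (the piece selections the player prefers at $x$, i.e. those the player considers not worse than any other piece selection at $x$); each player's preferences depend only on that player. Assumptions: (hungry) a player prefers a nonempty piece in a cake to an empty piece in that cake, with the pieces in the other cakes fixed; hence no $s\in\mathrm{Pref}(x)$ contains an empty piece, i.e. $x_{i,s(i)}>0$ for all $i$; (closed) for every piece selection $s$, the set of divisions $x$ with $s\in\mathrm{Pref}(x)$ is closed, i.e. if $s$ is preferred along a convergent sequence of divisions, it is preferred at the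 limit. A player who receives a piece selection in $\mathrm{Pref}(x)$ envies no other piece selection (envy-free). *)

theory Defs
  imports "HOL-Analysis.Analysis"
begin

text \<open>The finite type \<open>'m\<close> indexes the cakes and \<open>'k\<close> the pieces of each cake, so
  \<open>x $ i $ j\<close> is the length of the \<open>j\<close>-th piece of the \<open>i\<close>-th cake.\<close>

definition divisions :: "(real ^ ('k::finite) ^ ('m::finite)) set" where
  "divisions = {x. (\<forall>i j. 0 \<le> x $ i $ j) \<and> (\<forall>i. (\<Sum>j\<in>UNIV. x $ i $ j) = 1)}"

type_synonym ('m, 'k) piece_selection = "'m \<Rightarrow> 'k"

text \<open>The values of a preference correspondence outside \<^const>\<open>divisions\<close> are irrelevant.\<close>

type_synonym ('m, 'k) preference = "real^'k^'m \<Rightarrow> ('m, 'k) piece_selection set"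

definition different :: "('m, 'k) piece_selection \<Rightarrow> ('m, 'k) piece_selection \<Rightarrow> bool" where
  "different s s' \<longleftrightarrow> (\<exists>i. s i \<noteq> s' i)"

definition nonempty_preference :: "('m::finite, 'k::finite) preference \<Rightarrow> bool" where
  "nonempty_preference Pref \<longleftrightarrow> (\<forall>x\<in>divisions. Pref x \<noteq> {})"

text \<open>The model records only the preferred selections, so hungriness (a nonempty piece is preferred to
  an empty one in the same cake) is expressed as: no preferred selection contains an empty piece.\<close>

definition hungry :: "('m::finite, 'k::finite) preference \<Rightarrow> bool" where
  "hungry Pref \<longleftrightarrow> (\<forall>x\<in>divisions. \<forall>s\<in>Pref x. \<forall>i. x $ i $ s i > 0)"

text \<open>Since \<^const>\<open>divisions\<close> is closed in the ambient space, closedness in the ambient space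
  coincides with closedness relative to the set of divisions.\<close>

definition closed_preference :: "('m::finite, 'k::finite) preference \<Rightarrow> bool" where
  "closed_preference Pref \<longleftrightarrow> (\<forall>s. closed {x \<in> divisions. s \<in> Pref x})"

definition preference_correspondence :: "('m::finite, 'k::finite) preference \<Rightarrow> bool" where
  "preference_correspondence Pref \<longleftrightarrow>
     nonempty_preference Pref \<and> hungry Pref \<and> closed_preference Pref"

end

theory Submission
  imports Defs
begin

text \<open>
  The divisions form a polytope of dimension \<open>n = m (k - 1)\<close> whose vertices correspond to the piece
  selections; it suffices to treat \<open>n + 1\<close> players, repeating one of them if necessary. Cover the
  polytope by \<open>n + 1\<close> families of small sets such that the members of each family are disjoint, give
  the \<open>j\<close>-th family to player \<open>j\<close>, and label each of its members by a selection that player \<open>j\<close>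
  prefers at some point of it. Averaging the labels with a partition of unity yields a continuous self-map
  \<open>F\<close> of the polytope. As players are hungry, \<open>F\<close> preserves every face, so by Brouwer's theorem \<open>F\<close>
  attains a generic point \<open>y\<close>, one lying in no hull of \<open>n\<close> vertices. At a preimage of \<open>y\<close> every family
  contributes and all contributed vertices are different, so nearby every player
  prefers a selection of his own. Let the mesh of the cover tend to 0.
\<close>

section \<open>Underdetermined linear systems\<close>

text \<open>Gaussian elimination: each induction step removes one equation and at most one unknown,
  so an unknown is left when the equations are used up.\<close>

lemma homogeneous_system_nontrivial_solution:
  fixes M :: "'v \<Rightarrow> 'c \<Rightarrow> 'a::field"
  assumes "finite V" "finite A" "card V < card A"
  shows "\<exists>a. (\<exists>c\<in>A. a c \<noteq> 0) \<and> (\<forall>v\<in>V. (\<Sum>c\<in>A. a c * M v c) = 0)"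
  using assms
proof (induction V arbitrary: A M rule: finite_induct)
  case empty
  then have "A \<noteq> {}" by auto
  then show ?case by (intro exI[of _ "\<lambda>_. 1"]) auto
next
  case (insert v V)
  show ?case
  proof (cases "\<forall>c\<in>A. M v c = 0")
    case True
    then show ?thesis using insert.IH[of A M] insert.prems insert.hyps by auto
  next
    case False
    then obtain e where e: "e \<in> A" "M v e \<noteq> 0" by blast
    define A' where "A' = A - {e}"
    have A': "finite A'" "e \<notin> A'" "A = insert e A'" "card V < card A'"
      using insert.prems insert.hyps e by (auto simp: A'_def)
    obtain a where a: "\<exists>c\<in>A'. a c \<noteq> 0"
      "\<forall>u\<in>V. (\<Sum>c\<in>A'. a c * (M u c - M u e * M v c / M v e)) = 0"
      using insert.IH[OF A'(1,4), of "\<lambda>u c. M u c - M u e * M v c / M v e"] by blast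
    \<comment> \<open>The value at the pivot \<open>e\<close> solves equation \<open>v\<close>;
      substituting it into the other equations gives the reduced system that \<open>a\<close>
      solves.\<close>
    define b where "b = a(e := - (\<Sum>c\<in>A'. a c * M v c) / M v e)"
    have sum_b: "(\<Sum>c\<in>A. b c * M u c) = (\<Sum>c\<in>A'. a c * (M u c - M u e * M v c / M v e))" for u
    proof -
      have "(\<Sum>c\<in>A. b c * M u c) = b e * M u e + (\<Sum>c\<in>A'. a c * M u c)"
        using A'(1-3) by (auto simp: b_def intro!: sum.cong)
      also have "b e * M u e = - (M u e / M v e * (\<Sum>c\<in>A'. a c * M v c))"
        by (simp add: b_def)
      also have "\<dots> = - (\<Sum>c\<in>A'. a c * (M u e * M v c / M v e))"
        unfolding sum_distrib_left by (simp add: mult_ac)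
      finally show ?thesis by (simp add: algebra_simps sum_subtractf)
    qed
    have "\<exists>c\<in>A. b c \<noteq> 0"
      using a(1) A'(2,3) by (auto simp: b_def)
    moreover have "(\<Sum>c\<in>A. b c * M v c) = 0"
      using e(2) by (simp add: sum_b)
    moreover have "\<forall>u\<in>V. (\<Sum>c\<in>A. b c * M u c) = 0"
      using a(2) by (simp add: sum_b)
    ultimately show ?thesis by blast
  qed
qed

section \<open>The polytope of divisions\<close>

lemma convex_divisions: "convex (divisions :: (real ^ ('k::finite) ^ ('m::finite)) set)"
  unfolding convex_def divisions_def
  by (auto simp: sum.distrib simp flip: sum_distrib_left)

lemma closed_divisions: "closed (divisions :: (real ^ ('k::finite) ^ ('m::finite)) set)"
proof -
  have eq: "divisions = (\<Inter>i. \<Inter>j. {x :: real^'k^'m. 0 \<le> x $ i $ j}) \<inter> (\<Inter>i. {x. (\<Sum>j\<in>UNIV. x $ i $ j) = 1})"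
    by (auto simp: divisions_def)
  show ?thesis unfolding eq
    by (intro closed_INT closed_Int closed_Collect_le closed_Collect_eq continuous_intros ballI)
qed

lemma divisions_le_1:
  assumes "x \<in> divisions" shows "x $ i $ j \<le> 1"
  using assms member_le_sum[of j UNIV "\<lambda>j. x $ i $ j"] by (auto simp: divisions_def)

lemma compact_divisions: "compact (divisions :: (real ^ ('k::finite) ^ ('m::finite)) set)"
proof -
  have "norm x \<le> real CARD('m) * real CARD('k)" if "x \<in> divisions" for x :: "real^'k^'m"
  proof -
    have "norm (x $ i) \<le> real CARD('k)" for i
    proof -
      have "norm (x $ i) \<le> (\<Sum>j\<in>UNIV. \<bar>x $ i $ j\<bar>)" by (rule norm_le_l1_cart)
      also have "\<dots> \<le> (\<Sum>j\<in>(UNIV::'k set). 1)"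
        using that divisions_le_1[OF that] by (intro sum_mono) (auto simp: divisions_def)
      finally show ?thesis by simp
    qed
    then have "(\<Sum>i\<in>UNIV. norm (x $ i)) \<le> (\<Sum>i\<in>(UNIV::'m set). real CARD('k))"
      by (intro sum_mono)
    moreover have "norm x \<le> (\<Sum>i\<in>UNIV. norm (x $ i))"
      by (simp add: norm_vec_def L2_set_le_sum)
    ultimately show ?thesis by simp
  qed
  then have "bounded (divisions :: (real^'k^'m) set)" by (auto simp: bounded_iff)
  with closed_divisions show ?thesis by (simp add: compact_eq_bounded_closed)
qed

lemma divisions_nonempty: "(divisions :: (real ^ ('k::finite) ^ ('m::finite)) set) \<noteq> {}"
proof -
  have "(\<chi> i j. 1 / real CARD('k)) \<in> (divisions :: (real^'k^'m) set)"
    by (auto simp: divisions_def)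
  then show ?thesis by blast
qed

section \<open>Surjectivity of face-preserving maps\<close>

lemma face_preserving_imp_surj:
  fixes F :: "real ^ ('k::finite) ^ ('m::finite) \<Rightarrow> real ^ 'k ^ 'm"
  assumes cont: "continuous_on divisions F" and maps: "F \<in> divisions \<rightarrow> divisions"
    and face: "\<And>x i l. x \<in> divisions \<Longrightarrow> x $ i $ l = 0 \<Longrightarrow> F x $ i $ l = 0"
    and y: "y \<in> divisions"
  shows "\<exists>x\<in>divisions. F x = y"
proof -
  txt \<open>Moving \<open>x\<close> towards the coordinates where \<open>F x\<close> falls short of \<open>y\<close> has only preimages of \<open>y\<close> as
    fixed points: if row \<open>i\<close> of \<open>F x\<close> fell short somewhere, \<open>x\<close> and hence \<open>F x\<close> would vanish wherever it
    exceeds \<open>y\<close>.\<close>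
  define r where "r x i l = max 0 (y $ i $ l - F x $ i $ l)" for x i l
  define G where "G x = (\<chi> i l. (x $ i $ l + r x i l) / (1 + (\<Sum>l\<in>UNIV. r x i l)))" for x
  have r_nonneg: "0 \<le> r x i l" for x i l by (simp add: r_def)
  have den: "1 + (\<Sum>l\<in>UNIV. r x i l) > 0" for x i
    by (smt (verit) r_nonneg sum_nonneg)
  have contr: "continuous_on divisions (\<lambda>x. r x i l)" for i l
    unfolding r_def by (intro continuous_intros cont)
  have "continuous_on divisions G"
    unfolding G_def using den by (intro continuous_intros contr) (metis less_irrefl)
  moreover have "G \<in> divisions \<rightarrow> divisions"
  proof
    fix x :: "real^'k^'m" assume "x \<in> divisions"
    then have x: "0 \<le> x $ i $ l" "(\<Sum>l\<in>UNIV. x $ i $ l) = 1" for i l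
      by (auto simp: divisions_def)
    show "G x \<in> divisions"
      using den[of x] x r_nonneg
      by (auto simp: divisions_def G_def sum.distrib less_imp_le simp flip: sum_divide_distrib)
         (metis less_irrefl)
  qed
  ultimately obtain x where x: "x \<in> divisions" "G x = x"
    using brouwer[OF compact_divisions convex_divisions divisions_nonempty] by metis
  have "F x $ i $ l = y $ i $ l" for i l
  proof -
    have fixp: "x $ i $ l * (\<Sum>l\<in>UNIV. r x i l) = r x i l" for l
    proof -
      have "x $ i $ l = (x $ i $ l + r x i l) / (1 + (\<Sum>l\<in>UNIV. r x i l))"
        using x(2) by (metis (no_types, lifting) G_def vec_lambda_beta)
      with den[of x i] show ?thesis by (simp add: field_simps)
    qed
    have sums: "(\<Sum>l\<in>UNIV. F x $ i $ l) = 1" "(\<Sum>l\<in>UNIV. y $ i $ l) = 1"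
      using maps x(1) y by (auto simp: divisions_def)
    have le: "y $ i $ l \<le> F x $ i $ l" for l
    proof (rule ccontr)
      assume *: "\<not> ?thesis"
      then have "r x i l > 0" by (simp add: r_def)
      then have pos: "(\<Sum>l\<in>UNIV. r x i l) > 0"
        by (metis fixp less_irrefl mult_zero_right order_le_less r_nonneg sum_nonneg)
      \<comment> \<open>Both rows sum to 1, so a shortfall at \<open>l\<close> entails an excess
        elsewhere.\<close>
      obtain l' where l': "F x $ i $ l' > y $ i $ l'"
      proof (rule ccontr)
        assume "\<not> thesis"
        then have "\<forall>l'\<in>UNIV. F x $ i $ l' \<le> y $ i $ l'" using that by (meson not_le)
        with * have "(\<Sum>l\<in>UNIV. F x $ i $ l) < (\<Sum>l\<in>UNIV. y $ i $ l)"
          by (intro sum_strict_mono_ex1) (auto simp: not_le)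
        with sums show False by simp
      qed
      then have "r x i l' = 0" by (simp add: r_def)
      with fixp[of l'] pos have "x $ i $ l' = 0" by simp
      then have "F x $ i $ l' = 0" by (rule face[OF x(1)])
      moreover have "0 \<le> y $ i $ l'" using y by (simp add: divisions_def)
      ultimately show False using l' by simp
    qed
    show ?thesis
    proof (rule ccontr)
      assume "F x $ i $ l \<noteq> y $ i $ l"
      then have "y $ i $ l < F x $ i $ l" using le[of l] by simp
      then have "(\<Sum>l\<in>UNIV. y $ i $ l) < (\<Sum>l\<in>UNIV. F x $ i $ l)"
        using le by (intro sum_strict_mono_ex1) auto
      with sums show False by simp
    qed
  qed
  then show ?thesis using x(1) by (auto simp: vec_eq_iff)
qed


section \<open>Vertices and generic points\<close>

definition vertex :: "('m::finite \<Rightarrow> 'k::finite) \<Rightarrow> real ^ 'k ^ 'm" where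
  "vertex s = (\<chi> i l. of_bool (s i = l))"

lemma generic_division:
  "\<exists>y\<in>(divisions :: (real ^ ('k::finite) ^ ('m::finite)) set).
     \<forall>V c. card V \<le> CARD('m) * (CARD('k) - 1) \<longrightarrow> y \<noteq> (\<Sum>s\<in>V. c s *\<^sub>R vertex s)"
proof -
  define n where "n = CARD('m) * (CARD('k) - 1)"
  fix k0 :: 'k
  define C where "C = (UNIV :: 'm set) \<times> (UNIV - {k0})"
  have "finite C" "card C = n" by (simp_all add: C_def n_def card_cartesian_product)
  then obtain h where h: "bij_betw h C {1..n}"
    by (metis ex_bij_betw_finite_nat bij_betw_iff_card card_atLeastAtMost diff_Suc_1 finite_atLeastAtMost)
  txt \<open>The points of the hull of \<open>n\<close> vertices satisfy a fixed nontrivial affine equation in the \<open>n\<close>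
    coordinates in \<open>C\<close>, and along the moment curve \<open>y\<close> that equation is a nonzero polynomial in \<open>t\<close>.\<close>
  define y :: "real \<Rightarrow> real^'k^'m" where
    "y t = (\<chi> i l. if l = k0 then 1 - (\<Sum>l\<in>UNIV - {k0}. t ^ h (i, l)) else t ^ h (i, l))" for t
  \<comment> \<open>\<open>M s\<close> lists 1, for the constant term, followed by the coordinates
    of \<open>vertex s\<close> in \<open>C\<close>.\<close>
  define M :: "('m \<Rightarrow> 'k) \<Rightarrow> nat \<Rightarrow> real" where
    "M s r = (if r = 0 then 1 else case inv_into C h r of (i, l) \<Rightarrow> of_bool (s i = l))" for s r
  \<comment> \<open>There are \<open>n + 1\<close> unknowns and at most \<open>n\<close> equations.
    Larger sets \<open>V\<close> also get a nonzero \<open>a\<close>, so that every polynomial below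
    has finitely many roots.\<close>
  have "\<exists>a. (\<exists>r\<le>n. a r \<noteq> 0) \<and> (card V \<le> n \<longrightarrow> (\<forall>s\<in>V. (\<Sum>r\<le>n. a r * M s r) = 0))" for V
    using homogeneous_system_nontrivial_solution[of V "{..n}" M] by (cases "card V \<le> n") (auto 0 3)
  then obtain a where a: "\<And>V. \<exists>r\<le>n. a V r \<noteq> 0"
    "\<And>V s. card V \<le> n \<Longrightarrow> s \<in> V \<Longrightarrow> (\<Sum>r\<le>n. a V r * M s r) = 0"
    by metis
  \<comment> \<open>There are only finitely many sets \<open>V\<close> of selections, so all but
    finitely many \<open>t\<close> avoid all roots at once.\<close>
  have "finite (\<Union>V. {t. (\<Sum>r\<le>n. a V r * t ^ r) = 0})"
    using a(1) by (auto simp: polyfun_finite_roots)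
  moreover have "infinite {0<..<1 / real CARD('k)}"
    by (simp add: infinite_Ioo)
  ultimately have "infinite ({0<..<1 / real CARD('k)} - (\<Union>V. {t. (\<Sum>r\<le>n. a V r * t ^ r) = 0}))"
    by (rule Diff_infinite_finite)
  then obtain t where "t \<in> {0<..<1 / real CARD('k)} - (\<Union>V. {t. (\<Sum>r\<le>n. a V r * t ^ r) = 0})"
    using infinite_imp_nonempty by blast
  then have t: "0 < t" "t < 1 / real CARD('k)" "\<And>V. (\<Sum>r\<le>n. a V r * t ^ r) \<noteq> 0"
    by auto
  have t1: "t \<le> 1"
  proof -
    have "1 / real CARD('k) \<le> 1" by (simp add: divide_le_eq_1)
    with t(2) show ?thesis by linarith
  qed
  have "y t \<in> divisions"
  proof -
    \<comment> \<open>The exponents are at least 1, so each power is at most \<open>t\<close>, which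
      is below \<open>1 / real CARD('k)\<close>; this keeps the entry at \<open>k0\<close>
      nonnegative.\<close>
    have "(\<Sum>l\<in>UNIV - {k0}. t ^ h (i, l)) \<le> 1" for i
    proof -
      have "t ^ h (i, l) \<le> 1 / real CARD('k)" if "l \<noteq> k0" for l
      proof -
        have "h (i, l) \<ge> 1" using h that by (auto simp: bij_betw_def C_def)
        then have "t ^ h (i, l) \<le> t ^ 1" using t t1 by (intro power_decreasing) auto
        then show ?thesis using t(2) by simp
      qed
      then have "(\<Sum>l\<in>UNIV - {k0}. t ^ h (i, l)) \<le> (\<Sum>l\<in>UNIV - {k0}. 1 / real CARD('k))"
        by (intro sum_mono) auto
      also have "\<dots> \<le> (\<Sum>l\<in>(UNIV :: 'k set). 1 / real CARD('k))"
        by (intro sum_mono2) auto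
      finally show ?thesis by simp
    qed
    moreover have "(\<Sum>l\<in>UNIV. y t $ i $ l) = 1" for i
      by (subst sum.remove[of _ k0]) (auto simp: y_def intro!: sum.cong)
    ultimately show ?thesis using t(1) by (auto simp: divisions_def y_def)
  qed
  moreover have "y t \<noteq> (\<Sum>s\<in>V. c s *\<^sub>R vertex s)" if V: "card V \<le> n" for V c
  proof
    assume eq: "y t = (\<Sum>s\<in>V. c s *\<^sub>R vertex s)"
    have coord: "y t $ i $ l = (\<Sum>s\<in>V. c s * of_bool (s i = l))" for i l
      unfolding eq by (simp add: vertex_def)
    \<comment> \<open>The constant 1 comes from the sum of a row, the other powers from the entries
      in \<open>C\<close>.\<close>
    have "t ^ r = (\<Sum>s\<in>V. c s * M s r)" if "r \<le> n" for r
    proof (cases "r = 0")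
      case True
      have "1 = (\<Sum>l\<in>UNIV. y t $ i $ l)" for i
        using \<open>y t \<in> divisions\<close> by (auto simp: divisions_def)
      also have "\<dots> i = (\<Sum>s\<in>V. \<Sum>l\<in>UNIV. c s * of_bool (s i = l))" for i
        unfolding coord by (rule sum.swap)
      finally show ?thesis using True by (simp add: M_def flip: sum_distrib_left)
    next
      case False
      then have r: "r \<in> {1..n}" using that by auto
      obtain i l where il: "inv_into C h r = (i, l)" by (cases "inv_into C h r")
      have "(i, l) \<in> C" "h (i, l) = r"
        using h r il by (metis bij_betw_def inv_into_into, metis bij_betw_def f_inv_into_f)
      then have "t ^ r = y t $ i $ l" by (auto simp: y_def C_def)
      then show ?thesis using False by (simp add: coord M_def il)
    qed
    then have "(\<Sum>r\<le>n. a V r * t ^ r) = (\<Sum>r\<le>n. \<Sum>s\<in>V. c s * (a V r * M s r))"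
      by (intro sum.cong) (auto simp: sum_distrib_left mult_ac)
    also have "\<dots> = (\<Sum>s\<in>V. c s * (\<Sum>r\<le>n. a V r * M s r))"
      unfolding sum_distrib_left by (rule sum.swap)
    also have "\<dots> = 0" using a(2)[OF V] by simp
    finally show False using t(3) by blast
  qed
  ultimately show ?thesis unfolding n_def by blast
qed

section \<open>Uniform hungriness and coloured covers\<close>

text \<open>The length of a selected piece is continuous and positive on the compact set of
  divisions at which the selection is preferred, so it has a positive minimum there; only finitely
  many players, selections and cakes occur.\<close>

lemma uniformly_hungry:
  fixes Q :: "'j \<Rightarrow> ('m::finite, 'k::finite) preference"
  assumes "finite J" "\<And>j. j \<in> J \<Longrightarrow> preference_correspondence (Q j)"
  shows "\<exists>e>0. \<forall>j\<in>J. \<forall>x\<in>divisions. \<forall>s\<in>Q j x. \<forall>i. e \<le> x $ i $ s i"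
proof -
  have "\<exists>e>0. \<forall>x\<in>divisions. s \<in> Q j x \<longrightarrow> e \<le> x $ i $ s i" if "j \<in> J" for j s i
  proof (cases "{x \<in> divisions. s \<in> Q j x} = {}")
    case True
    then show ?thesis by (intro exI[of _ 1]) auto
  next
    case False
    have "closed {x \<in> divisions. s \<in> Q j x}"
      using assms(2)[OF that] by (simp add: preference_correspondence_def closed_preference_def)
    then have "compact (divisions \<inter> {x \<in> divisions. s \<in> Q j x})"
      by (intro compact_Int_closed compact_divisions)
    then have "compact {x \<in> divisions. s \<in> Q j x}"
      by (rule back_subst[of compact]) auto
    moreover have "continuous_on {x \<in> divisions. s \<in> Q j x} (\<lambda>x. x $ i $ s i)"
      by (intro continuous_intros)
    ultimately obtain x0 where x0: "x0 \<in> divisions" "s \<in> Q j x0"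
      "\<forall>x\<in>{x \<in> divisions. s \<in> Q j x}. x0 $ i $ s i \<le> x $ i $ s i"
      using continuous_attains_inf[OF _ False] by blast
    moreover have "x0 $ i $ s i > 0"
      using assms(2)[OF that] x0 by (simp add: preference_correspondence_def hungry_def)
    ultimately show ?thesis by blast
  qed
  then obtain f where f: "\<And>j s i. j \<in> J \<Longrightarrow> f j s i > 0"
    "\<And>j s i x. j \<in> J \<Longrightarrow> x \<in> divisions \<Longrightarrow> s \<in> Q j x \<Longrightarrow> f j s i \<le> x $ i $ s i"
    by metis
  \<comment> \<open>The element 1 keeps \<open>E\<close> nonempty when \<open>J\<close> is
    empty.\<close>
  define E where "E = insert 1 ((\<lambda>(j, s, i). f j s i) ` (J \<times> UNIV \<times> UNIV))"
  have E: "finite E" "E \<noteq> {}" "\<And>j s i. j \<in> J \<Longrightarrow> f j s i \<in> E"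
    using assms(1) by (auto simp: E_def intro!: image_eqI[of _ _ "(_, _, _)"])
  have "Min E > 0" using E(1,2) f(1) by (auto simp: E_def)
  moreover have "Min E \<le> x $ i $ s i" if "j \<in> J" "x \<in> divisions" "s \<in> Q j x" for j x s i
    using Min_le[OF E(1) E(3)] f(2) that by (meson order_trans)
  ultimately show ?thesis by blast
qed

text \<open>The family with colour \<open>j\<close> consists of the open cubes of the grid of mesh \<open>1/N\<close> shifted by
  \<open>j/(card C + 1)\<close> of a cell. Each coordinate of a point lies on a wall of at most one of the
  \<open>card C + 1\<close> shifted grids, so some colour covers the point.\<close>

lemma colored_partition_of_unity:
  fixes g :: "'c \<Rightarrow> 'a::topological_space \<Rightarrow> real" and N :: nat
  assumes C: "finite C" and N: "N > 0"
    and cont: "\<And>c. c \<in> C \<Longrightarrow> continuous_on S (g c)"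
    and range: "\<And>c x. c \<in> C \<Longrightarrow> x \<in> S \<Longrightarrow> g c x \<in> {0..1}"
  obtains Z :: "('c \<Rightarrow> int) set" and w :: "nat \<Rightarrow> ('c \<Rightarrow> int) \<Rightarrow> 'a \<Rightarrow> real"
  where "finite Z"
    and "\<And>j z. continuous_on S (w j z)"
    and "\<And>j z x. 0 \<le> w j z x"
    and "\<And>x. x \<in> S \<Longrightarrow> (\<Sum>j\<le>card C. \<Sum>z\<in>Z. w j z x) = 1"
    and "\<And>j z z' x. z \<in> Z \<Longrightarrow> z' \<in> Z \<Longrightarrow> w j z x > 0 \<Longrightarrow> w j z' x > 0 \<Longrightarrow> z = z'"
    and "\<And>j z x y c. c \<in> C \<Longrightarrow> w j z x > 0 \<Longrightarrow> w j z y > 0 \<Longrightarrow> \<bar>g c x - g c y\<bar> < 1 / real N"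
proof -
  define n where "n = card C"
  define bump :: "real \<Rightarrow> real" where "bump t = max 0 (1/2 - \<bar>t - 1/2\<bar>)" for t
  define u where "u j c x = real N * g c x - real j / real (Suc n)" for j c x
  \<comment> \<open>Positive exactly when \<open>x\<close> lies, in the coordinates
    \<open>g\<close>, in the open cell \<open>z\<close> of the grid with shift \<open>j\<close>;
    division by the sum \<open>T\<close> turns these functions into the weights.\<close>
  define b where "b j z x = (\<Prod>c\<in>C. bump (u j c x - of_int (z c)))"
    for j :: nat and z :: "'c \<Rightarrow> int" and x
  \<comment> \<open>A shift by less than 1 moves the range of \<open>u j c\<close> from [0, N] into
    [-1, N]. \<open>PiE\<close> fixes the values outside \<open>C\<close>, so different indices mean
    different cells.\<close>
  define Z where "Z = PiE C (\<lambda>_. {-1..int N})"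
  define T where "T x = (\<Sum>j\<le>n. \<Sum>z\<in>Z. b j z x)" for x
  have Z: "finite Z" using C by (simp add: Z_def finite_PiE)
  have bump_nonneg: "0 \<le> bump t" for t by (simp add: bump_def)
  have bump_pos: "bump t > 0 \<longleftrightarrow> 0 < t \<and> t < 1" for t by (auto simp: bump_def max_def abs_if)
  have b_nonneg: "0 \<le> b j z x" for j z x by (simp add: b_def prod_nonneg bump_nonneg)
  have T_nonneg: "0 \<le> T x" for x by (simp add: T_def sum_nonneg b_nonneg)
  have b_pos: "b j z x > 0 \<longleftrightarrow> (\<forall>c\<in>C. of_int (z c) < u j c x \<and> u j c x < of_int (z c) + 1)" for j z x
  proof -
    have "b j z x > 0 \<longleftrightarrow> (\<forall>c\<in>C. bump (u j c x - of_int (z c)) > 0)"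
      using C bump_nonneg b_nonneg[of j z x] by (auto simp: b_def prod_pos less_le)
    then show ?thesis by (simp add: bump_pos) (smt (verit))
  qed
  have T_pos: "T x > 0" if x: "x \<in> S" for x
  proof -
    txt \<open>\<open>Bad c\<close> collects the colours for which coordinate \<open>c\<close> of \<open>x\<close> lies on a wall of the grid.\<close>
    define Bad where "Bad c = {j. j \<le> n \<and> u j c x \<in> \<int>}" for c
    have "card (Bad c) \<le> 1" for c
    proof -
      have "j = j'" if "j \<in> Bad c" "j' \<in> Bad c" for j j'
      proof -
        \<comment> \<open>The difference is \<open>(j - j') / (n + 1)\<close>, of absolute value
          less than 1, so it is an integer only for \<open>j = j'\<close>.\<close>
        have "u j' c x - u j c x \<in> \<int>" using that by (auto simp: Bad_def)
        then obtain q where "(real j - real j') / real (Suc n) = of_int q"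
          by (auto simp: u_def diff_divide_distrib elim!: Ints_cases)
        then have "real_of_int (int j - int j') = of_int (q * int (Suc n))"
          by (simp add: field_simps)
        then have q: "int j - int j' = q * int (Suc n)" by linarith
        have "\<bar>int j - int j'\<bar> < int (Suc n)" using that by (auto simp: Bad_def)
        then have "q = 0" unfolding q abs_mult by (auto simp: abs_if split: if_splits)
        with q show ?thesis by simp
      qed
      then show ?thesis by (auto simp: card_le_Suc0_iff_eq Bad_def)
    qed
    then have "(\<Sum>c\<in>C. card (Bad c)) \<le> (\<Sum>c\<in>C. 1)" by (intro sum_mono)
    then have "card (\<Union>c\<in>C. Bad c) \<le> n"
      using card_UN_le[OF C, of Bad] by (simp add: n_def)
    \<comment> \<open>Each of the \<open>n\<close> coordinates spoils at most one of the
      \<open>n + 1\<close> colours.\<close>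
    then have "\<not> {..n} \<subseteq> (\<Union>c\<in>C. Bad c)"
      using card_mono[of "\<Union>c\<in>C. Bad c" "{..n}"] C by (auto simp: Bad_def)
    then obtain j where j: "j \<le> n" "\<And>c. c \<in> C \<Longrightarrow> u j c x \<notin> \<int>" by (auto simp: Bad_def)
    define z where "z = restrict (\<lambda>c. \<lfloor>u j c x\<rfloor>) C"
    have "z \<in> Z"
      unfolding Z_def
    proof
      fix c assume c: "c \<in> C"
      have "0 \<le> real N * g c x" "real N * g c x \<le> real N" "real j / real (Suc n) \<le> 1"
        using range[OF c x] j(1) by (auto simp: mult_left_le)
      moreover have "0 \<le> real j / real (Suc n)" by simp
      ultimately have "-1 \<le> u j c x" "u j c x \<le> real N" unfolding u_def by linarith+
      then show "z c \<in> {-1..int N}" using c by (simp add: z_def le_floor_iff floor_le_iff)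
    qed (simp add: z_def)
    have "of_int \<lfloor>u j c x\<rfloor> \<noteq> u j c x" if "c \<in> C" for c
      using j(2)[OF that] by (metis Ints_of_int)
    then have "b j z x > 0"
      unfolding b_pos z_def using floor_correct by (auto simp: less_le)
    also have "b j z x \<le> (\<Sum>z\<in>Z. b j z x)"
      using Z \<open>z \<in> Z\<close> b_nonneg by (intro member_le_sum) auto
    also have "\<dots> \<le> T x"
      unfolding T_def using j(1) by (intro member_le_sum[where i = j]) (auto intro: sum_nonneg b_nonneg)
    finally show ?thesis .
  qed
  have contb: "continuous_on S (b j z)" for j z
    unfolding b_def bump_def u_def by (intro continuous_intros cont)
  show thesis
  proof (rule that[of Z "\<lambda>j z x. b j z x / T x"])
    show "finite Z" by fact
    have "continuous_on S T" unfolding T_def by (intro continuous_intros contb)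
    moreover have "\<forall>x\<in>S. T x \<noteq> 0" using T_pos by (metis less_irrefl)
    ultimately show "continuous_on S (\<lambda>x. b j z x / T x)" for j z
      by (intro continuous_on_divide contb)
    \<comment> \<open>Where \<open>T x\<close> is 0, which may happen outside \<open>S\<close>, the
      quotient is 0 by convention.\<close>
    show "0 \<le> b j z x / T x" for j z x by (simp add: b_nonneg T_nonneg)
    show "(\<Sum>j\<le>card C. \<Sum>z\<in>Z. b j z x / T x) = 1" if "x \<in> S" for x
      using T_pos[OF that] by (simp add: T_def n_def flip: sum_divide_distrib)
    show "z = z'" if "z \<in> Z" "z' \<in> Z" "b j z x / T x > 0" "b j z' x / T x > 0" for j z z' x
    proof -
      have "b j z x > 0" "b j z' x > 0"
        using that(3,4) T_nonneg[of x] b_nonneg by (auto simp: zero_less_divide_iff)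
      \<comment> \<open>On \<open>C\<close>, both \<open>z c\<close> and \<open>z' c\<close> are the
        floor of \<open>u j c x\<close>.\<close>
      then have "\<forall>c\<in>C. z c = z' c" unfolding b_pos by (smt (verit) of_int_less_iff floor_unique)
      then show ?thesis using that(1,2) by (auto simp: Z_def intro: PiE_ext)
    qed
    show "\<bar>g c x - g c y\<bar> < 1 / real N" if "c \<in> C" "b j z x / T x > 0" "b j z y / T y > 0" for j z x y c
    proof -
      have "b j z x > 0" "b j z y > 0"
        using that(2,3) T_nonneg[of x] T_nonneg[of y] by (auto simp: zero_less_divide_iff)
      then have "\<bar>u j c x - u j c y\<bar> < 1" using that(1) unfolding b_pos by (smt (verit))
      moreover have "u j c x - u j c y = real N * (g c x - g c y)" by (simp add: u_def algebra_simps)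
      ultimately have "real N * \<bar>g c x - g c y\<bar> < 1" by (simp only: abs_mult abs_of_nat)
      then show ?thesis using N by (simp add: mult.commute pos_less_divide_eq)
    qed
  qed
qed

text \<open>Rows sum to 1, so the entry at \<open>k0\<close> changes by at most the total change of
  the others in its row. Thus closeness in the coordinates other than \<open>k0\<close>, which the
  cover controls, gives closeness in norm.\<close>

lemma dist_divisions_le:
  fixes x y :: "real ^ ('k::finite) ^ ('m::finite)"
  assumes "x \<in> divisions" "y \<in> divisions"
  shows "dist x y \<le> 2 * (\<Sum>(i, l)\<in>UNIV \<times> (UNIV - {k0}). \<bar>x $ i $ l - y $ i $ l\<bar>)"
proof -
  have row: "norm ((x - y) $ i) \<le> 2 * (\<Sum>l\<in>UNIV - {k0}. \<bar>x $ i $ l - y $ i $ l\<bar>)" for i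
  proof -
    have "(\<Sum>l\<in>UNIV. x $ i $ l - y $ i $ l) = 0"
      using assms by (simp add: divisions_def sum_subtractf)
    then have "x $ i $ k0 - y $ i $ k0 = - (\<Sum>l\<in>UNIV - {k0}. x $ i $ l - y $ i $ l)"
      by (subst (asm) sum.remove[of _ k0]) auto
    then have "\<bar>x $ i $ k0 - y $ i $ k0\<bar> = \<bar>\<Sum>l\<in>UNIV - {k0}. x $ i $ l - y $ i $ l\<bar>"
      by (simp only: abs_minus_cancel)
    also have "\<dots> \<le> (\<Sum>l\<in>UNIV - {k0}. \<bar>x $ i $ l - y $ i $ l\<bar>)"
      by (rule sum_abs)
    finally have "\<bar>x $ i $ k0 - y $ i $ k0\<bar> \<le> (\<Sum>l\<in>UNIV - {k0}. \<bar>x $ i $ l - y $ i $ l\<bar>)" .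
    moreover have "norm ((x - y) $ i) \<le> (\<Sum>l\<in>UNIV. \<bar>(x - y) $ i $ l\<bar>)" by (rule norm_le_l1_cart)
    moreover have "(\<Sum>l\<in>UNIV. \<bar>(x - y) $ i $ l\<bar>) =
        \<bar>x $ i $ k0 - y $ i $ k0\<bar> + (\<Sum>l\<in>UNIV - {k0}. \<bar>x $ i $ l - y $ i $ l\<bar>)"
      by (subst sum.remove[of UNIV k0]) auto
    ultimately show ?thesis by linarith
  qed
  have "dist x y \<le> (\<Sum>i\<in>UNIV. norm ((x - y) $ i))"
    unfolding dist_norm norm_vec_def[of "x - y"] by (simp add: L2_set_le_sum)
  also have "\<dots> \<le> (\<Sum>i\<in>UNIV. 2 * (\<Sum>l\<in>UNIV - {k0}. \<bar>x $ i $ l - y $ i $ l\<bar>))"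
    by (intro sum_mono row)
  finally show ?thesis by (simp add: sum.cartesian_product flip: sum_distrib_left)
qed

section \<open>Approximate solutions at a fixed mesh\<close>

text \<open>At a preimage \<open>x\<close> of a generic point, all \<open>n + 1\<close> colours
  contribute, with different labels. \<open>t j\<close> is the label of the cell of colour
  \<open>j\<close> active at \<open>x\<close>, and \<open>y j\<close> is the point of that cell
  where the label was sampled, so the preference is obtained near \<open>x\<close>.\<close>

lemma approximate_division:
  fixes Q :: "nat \<Rightarrow> ('m::finite, 'k::finite) preference"
  assumes n: "n = CARD('m) * (CARD('k) - 1)"
    and Q: "\<And>j. j \<le> n \<Longrightarrow> preference_correspondence (Q j)"
    and "\<epsilon> > 0"
  shows "\<exists>x\<in>divisions. \<exists>t y. inj_on t {..n} \<and>
    (\<forall>j\<le>n. y j \<in> divisions \<and> t j \<in> Q j (y j) \<and> dist (y j) x < \<epsilon>)"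
proof -
  obtain e where e: "e > 0" "\<And>j x s i. j \<le> n \<Longrightarrow> x \<in> divisions \<Longrightarrow> s \<in> Q j x \<Longrightarrow> e \<le> x $ i $ s i"
    using uniformly_hungry[of "{..n}" Q] Q by auto
  fix k0 :: 'k
  define C where "C = (UNIV :: 'm set) \<times> (UNIV - {k0})"
  have C: "finite C" "card C = n" by (simp_all add: C_def n card_cartesian_product)
  \<comment> \<open>\<open>\<epsilon>\<close> bounds the distances in the conclusion, and
    \<open>e\<close> makes \<open>F\<close> preserve faces.\<close>
  define \<delta> where "\<delta> = min \<epsilon> e"
  have "\<delta> > 0" using e(1) \<open>\<epsilon> > 0\<close> by (simp add: \<delta>_def)
  \<comment> \<open>The summand 1 keeps the bound positive for \<open>n = 0\<close>, so that
    \<open>N\<close> is positive.\<close>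
  obtain N :: nat where N: "2 * (real n + 1) / \<delta> < real N" using reals_Archimedean2 by blast
  moreover have "0 < 2 * (real n + 1) / \<delta>" using \<open>\<delta> > 0\<close> by simp
  ultimately have "N > 0" by (metis less_trans of_nat_0_less_iff)
  have mesh: "2 * (real n * (1 / real N)) < \<delta>"
    using N \<open>N > 0\<close> \<open>\<delta> > 0\<close> by (simp add: field_simps)
  obtain Z and w :: "nat \<Rightarrow> ('m \<times> 'k \<Rightarrow> int) \<Rightarrow> real^'k^'m \<Rightarrow> real" where Z: "finite Z"
    and w: "\<And>j z. continuous_on divisions (w j z)" "\<And>j z x. 0 \<le> w j z x"
      "\<And>x. x \<in> divisions \<Longrightarrow> (\<Sum>j\<le>n. \<Sum>z\<in>Z. w j z x) = 1"
      "\<And>j z z' x. z \<in> Z \<Longrightarrow> z' \<in> Z \<Longrightarrow> w j z x > 0 \<Longrightarrow> w j z' x > 0 \<Longrightarrow> z = z'"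
      "\<And>j z x y i l. (i, l) \<in> C \<Longrightarrow> w j z x > 0 \<Longrightarrow> w j z y > 0 \<Longrightarrow> \<bar>x $ i $ l - y $ i $ l\<bar> < 1 / real N"
  proof (rule colored_partition_of_unity[OF C(1) \<open>N > 0\<close>, of divisions "\<lambda>(i, l) x. x $ i $ l"])
    show "continuous_on divisions ((\<lambda>(i, l) x. x $ i $ l) c)" for c :: "'m \<times> 'k"
      by (cases c) (auto intro!: continuous_intros)
    show "(\<lambda>(i, l) x. x $ i $ l) c x \<in> {0..1}"
      if "x \<in> divisions" for c :: "'m \<times> 'k" and x :: "real^'k^'m"
      using that divisions_le_1[OF that] by (cases c) (auto simp: divisions_def)
  qed (use that C(2) in auto)
  have close: "dist x y < \<delta>" if "x \<in> divisions" "y \<in> divisions" "w j z x > 0" "w j z y > 0" for j z x y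
  proof -
    have "(\<Sum>(i, l)\<in>C. \<bar>x $ i $ l - y $ i $ l\<bar>) \<le> (\<Sum>c\<in>C. 1 / real N)"
      using w(5) that(3,4) by (intro sum_mono) (auto intro: less_imp_le)
    also have "\<dots> = real n * (1 / real N)" by (simp add: C(2))
    finally show ?thesis
      using dist_divisions_le[OF that(1,2), of k0] mesh by (simp add: C_def)
  qed
  \<comment> \<open>A cell that misses \<open>divisions\<close> gets an arbitrary division as its
    representative; it has weight 0 at every division.\<close>
  have "\<exists>y s. y \<in> divisions \<and> (j \<le> n \<longrightarrow> s \<in> Q j y) \<and> ((\<exists>x\<in>divisions. w j z x > 0) \<longrightarrow> w j z y > 0)"
    for j z
  proof -
    obtain y where y: "y \<in> divisions" "(\<exists>x\<in>divisions. w j z x > 0) \<longrightarrow> w j z y > 0"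
      using divisions_nonempty by blast
    have "j \<le> n \<Longrightarrow> Q j y \<noteq> {}"
      using Q y(1) by (simp add: preference_correspondence_def nonempty_preference_def)
    with y show ?thesis by blast
  qed
  then obtain rep \<sigma> where rep: "\<And>j z. rep j z \<in> divisions" "\<And>j z. j \<le> n \<Longrightarrow> \<sigma> j z \<in> Q j (rep j z)"
    "\<And>j z x. x \<in> divisions \<Longrightarrow> w j z x > 0 \<Longrightarrow> w j z (rep j z) > 0"
    by metis
  define F where "F x = (\<Sum>j\<le>n. \<Sum>z\<in>Z. w j z x *\<^sub>R vertex (\<sigma> j z))" for x
  have F_nth: "F x $ i $ l = (\<Sum>j\<le>n. \<Sum>z\<in>Z. w j z x * of_bool (\<sigma> j z i = l))" for x i l
    by (simp add: F_def vertex_def)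
  have "continuous_on divisions F"
    unfolding F_def by (intro continuous_intros w(1))
  moreover have "F \<in> divisions \<rightarrow> divisions"
  proof
    fix x :: "real^'k^'m" assume x: "x \<in> divisions"
    have "(\<Sum>l\<in>UNIV. F x $ i $ l) = (\<Sum>j\<le>n. \<Sum>z\<in>Z. \<Sum>l\<in>UNIV. w j z x * of_bool (\<sigma> j z i = l))" for i
      unfolding F_nth by (subst sum.swap, intro sum.cong refl, rule sum.swap)
    then have "(\<Sum>l\<in>UNIV. F x $ i $ l) = 1" for i
      using w(3)[OF x] by (simp flip: sum_distrib_left)
    moreover have "0 \<le> F x $ i $ l" for i l
      unfolding F_nth by (intro sum_nonneg mult_nonneg_nonneg w(2)) auto
    ultimately show "F x \<in> divisions" by (simp add: divisions_def)
  qed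
  moreover have "F x $ i $ l = 0" if x: "x \<in> divisions" "x $ i $ l = 0" for x i l
  proof -
    \<comment> \<open>A cell active at \<open>x\<close> whose label selects piece \<open>l\<close>
      of cake \<open>i\<close> has a representative in which that piece has length at least
      \<open>e\<close>, yet which is closer than \<open>e\<close> to \<open>x\<close>, where the
      piece is empty.\<close>
    have "w j z x * of_bool (\<sigma> j z i = l) = 0" if "j \<le> n" for j z
    proof (rule ccontr)
      assume "w j z x * of_bool (\<sigma> j z i = l) \<noteq> 0"
      then have *: "w j z x > 0" "\<sigma> j z i = l" using w(2)[of j z x] by (auto simp: less_le)
      have "e \<le> rep j z $ i $ l" using e(2)[OF that rep(1) rep(2)[OF that]] *(2) by metis
      also have "\<dots> \<le> dist (rep j z) x"
        using Finite_Cartesian_Product.norm_nth_le[of "(rep j z - x) $ i" l]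
          Finite_Cartesian_Product.norm_nth_le[of "rep j z - x" i] x(2) by (simp add: dist_norm)
      also have "\<dots> < \<delta>" by (rule close[OF rep(1) x(1) rep(3)[OF x(1) *(1)] *(1)])
      finally show False by (simp add: \<delta>_def)
    qed
    then show ?thesis unfolding F_nth by (intro sum.neutral ballI) simp
  qed
  moreover obtain y :: "real^'k^'m" where y: "y \<in> divisions"
    "\<And>V c. card V \<le> n \<Longrightarrow> y \<noteq> (\<Sum>s\<in>V. c s *\<^sub>R vertex s)"
    using generic_division unfolding n by metis
  ultimately obtain x where x: "x \<in> divisions" "F x = y"
    using face_preserving_imp_surj[of F y] by blast
  \<comment> \<open>At most one cell of each colour is active at \<open>x\<close>; if there is none,
    \<open>\<zeta> j\<close> is arbitrary.\<close>
  have "\<exists>z. \<forall>z'\<in>Z. w j z' x > 0 \<longrightarrow> z' = z" for j using w(4) by metis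
  then obtain \<zeta> where \<zeta>: "\<And>j z. z \<in> Z \<Longrightarrow> w j z x > 0 \<Longrightarrow> z = \<zeta> j" by metis
  define t where "t j = \<sigma> j (\<zeta> j)" for j
  define a where "a j = (\<Sum>z\<in>Z. w j z x)" for j
  define J where "J = {j. j \<le> n \<and> a j \<noteq> 0}"
  have "finite J" by (simp add: J_def)
  have "(\<Sum>z\<in>Z. w j z x *\<^sub>R vertex (\<sigma> j z)) = a j *\<^sub>R vertex (t j)" for j
    unfolding a_def scaleR_sum_left
    by (intro sum.cong refl) (metis \<zeta> less_le scaleR_zero_left t_def w(2))
  then have "y = (\<Sum>j\<le>n. a j *\<^sub>R vertex (t j))" using x(2) by (simp add: F_def)
  also have "\<dots> = (\<Sum>j\<in>J. a j *\<^sub>R vertex (t j))"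
    by (rule sum.mono_neutral_right) (auto simp: J_def)
  \<comment> \<open>Colours with equal labels are merged. Were a colour absent or a label repeated,
    at most \<open>n\<close> vertices would be left, contrary to the choice of
    \<open>y\<close>.\<close>
  also have "\<dots> = (\<Sum>s\<in>t ` J. (\<Sum>j | j \<in> J \<and> t j = s. a j) *\<^sub>R vertex s)"
    by (subst sum.image_gen[OF \<open>finite J\<close>, of _ t]) (auto simp: scaleR_sum_left intro!: sum.cong)
  finally have "\<not> card (t ` J) \<le> n"
    using y(2)[of "t ` J" "\<lambda>s. \<Sum>j | j \<in> J \<and> t j = s. a j"] by argo
  moreover have "card (t ` J) \<le> card J" "card J \<le> card {..n}"
    using \<open>finite J\<close> by (auto simp: J_def intro: card_image_le card_mono simp del: card_atMost)
  ultimately have card: "card (t ` J) = card J" "card J = card {..n}" by auto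
  then have J: "J = {..n}" by (intro card_subset_eq) (auto simp: J_def)
  have "inj_on t {..n}" using card(1) \<open>finite J\<close> J eq_card_imp_inj_on by metis
  moreover have "dist (rep j (\<zeta> j)) x < \<epsilon>" if "j \<le> n" for j
  proof -
    have "a j \<noteq> 0" using J that by (auto simp: J_def)
    then obtain z where "z \<in> Z" "w j z x \<noteq> 0" unfolding a_def by (metis sum.neutral)
    then have pos: "w j (\<zeta> j) x > 0" using \<zeta> w(2)[of j z x] by (metis less_le)
    have "dist (rep j (\<zeta> j)) x < \<delta>" by (rule close[OF rep(1) x(1) rep(3)[OF x(1) pos] pos])
    then show ?thesis by (simp add: \<delta>_def)
  qed
  ultimately show ?thesis
    using x(1) rep(1,2) by (intro bexI[of _ x] exI[of _ t] exI[of _ "\<lambda>j. rep j (\<zeta> j)"]) (auto simp: t_def)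
qed

section \<open>Passage to the limit\<close>

theorem theorem2:
  fixes Pref :: "nat \<Rightarrow> ('m::finite, 'k::finite) preference"
    and p :: nat
  assumes "p \<ge> 1"
    and "real CARD('k) \<ge> 1 + (real p - 1) / real CARD('m)"
    and "\<And>j. j \<in> {1..p} \<Longrightarrow> preference_correspondence (Pref j)"
  shows "\<exists>x\<in>divisions. \<exists>s :: nat \<Rightarrow> ('m, 'k) piece_selection.
           (\<forall>j\<in>{1..p}. \<forall>j'\<in>{1..p}. j \<noteq> j' \<longrightarrow> different (s j) (s j')) \<and>
           (\<forall>j\<in>{1..p}. s j \<in> Pref j x)"
proof -
  define n where "n = CARD('m) * (CARD('k) - 1)"
  have "real p - 1 \<le> real CARD('m) * (real CARD('k) - 1)"
    using assms(2) by (simp add: field_simps)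
  also have "\<dots> = real n" by (simp add: n_def of_nat_diff Suc_leI)
  finally have "p \<le> Suc n" by linarith
  \<comment> \<open>Players 1 to \<open>p\<close> get the indices 0 to \<open>p - 1\<close>; the
    remaining indices up to \<open>n\<close> repeat player 1.\<close>
  define Q where "Q j = Pref (if j < p then Suc j else 1)" for j
  have Q: "preference_correspondence (Q j)" for j
    using assms(1,3) by (auto simp: Q_def)
  define \<epsilon> where "\<epsilon> r = inverse (real (Suc r))" for r
  have "\<exists>x\<in>divisions. \<exists>t y. inj_on t {..n} \<and>
    (\<forall>j\<le>n. y j \<in> divisions \<and> t j \<in> Q j (y j) \<and> dist (y j) x < \<epsilon> r)" for r
    using approximate_division[OF n_def Q, of "\<epsilon> r"] by (simp add: \<epsilon>_def)
  then obtain X t Y where X: "\<And>r. X r \<in> divisions" "\<And>r. inj_on (t r) {..n}"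
    "\<And>r j. j \<le> n \<Longrightarrow> Y r j \<in> divisions \<and> t r j \<in> Q j (Y r j) \<and> dist (Y r j) (X r) < \<epsilon> r"
    by metis
  obtain x q where x: "x \<in> divisions" "strict_mono q" "(X \<circ> q) \<longlonglongrightarrow> x"
    using compact_divisions X(1) unfolding compact_def by metis
  \<comment> \<open>After restriction to \<open>{..n}\<close> only finitely many assignments of
    selections are left, so one of them recurs infinitely often along the convergent
    subsequence.\<close>
  define T where "T r = restrict (t (q r)) {..n}" for r
  have "finite (range T)"
    by (rule finite_subset[of _ "PiE {..n} (\<lambda>_. UNIV)"]) (auto simp: T_def intro!: finite_PiE)
  then obtain r0 where r0: "infinite {r. T r = T r0}"
    using pigeonhole_infinite[of UNIV T] by auto
  define s where "s j = T r0 (j - 1)" for j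
  have "s j \<in> Pref j x" if j: "j \<in> {1..p}" for j
  proof -
    define i where "i = j - 1"
    have i: "i \<le> n" "Q i = Pref j" using j \<open>p \<le> Suc n\<close> by (auto simp: i_def Q_def)
    \<comment> \<open>For infinitely many \<open>r\<close> the player prefers \<open>s j\<close> at
      \<open>Y (q r) i\<close>, and these points approach \<open>x\<close>.\<close>
    have "x \<in> closure {y \<in> divisions. s j \<in> Q i y}"
      unfolding closure_approachable
    proof (intro allI impI)
      fix d :: real assume "d > 0"
      have "(\<lambda>r. \<epsilon> (q r)) \<longlonglongrightarrow> 0"
        using LIMSEQ_subseq_LIMSEQ[OF LIMSEQ_inverse_real_of_nat x(2)] by (simp add: \<epsilon>_def o_def)
      moreover have "(\<lambda>r. dist (X (q r)) x) \<longlonglongrightarrow> 0"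
        using x(3) unfolding o_def by (rule iffD1[OF tendsto_dist_iff])
      ultimately have "(\<lambda>r. \<epsilon> (q r) + dist (X (q r)) x) \<longlonglongrightarrow> 0"
        by (rule tendsto_add_zero)
      then have "\<forall>\<^sub>F r in sequentially. \<epsilon> (q r) + dist (X (q r)) x < d"
        using \<open>d > 0\<close> by (rule order_tendstoD(2))
      then obtain R where R: "\<And>r. r \<ge> R \<Longrightarrow> \<epsilon> (q r) + dist (X (q r)) x < d"
        by (auto simp: eventually_sequentially)
      obtain r where r: "r \<ge> R" "T r = T r0"
        using r0 by (auto simp: infinite_nat_iff_unbounded_le)
      have "s j = t (q r) i" using i(1) r(2)[symmetric] by (simp add: s_def T_def i_def)
      moreover have "dist (Y (q r) i) x < d"
        using R[OF r(1)] X(3)[OF i(1), of "q r"] dist_triangle[of "Y (q r) i" x "X (q r)"] by linarith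
      ultimately show "\<exists>y\<in>{y \<in> divisions. s j \<in> Q i y}. dist y x < d"
        using X(3)[OF i(1), of "q r"] by auto
    qed
    moreover have "closed {y \<in> divisions. s j \<in> Q i y}"
      using Q[of i] by (simp add: preference_correspondence_def closed_preference_def)
    ultimately show ?thesis using i(2) by (simp add: closure_closed)
  qed
  moreover have "different (s j) (s j')" if "j \<in> {1..p}" "j' \<in> {1..p}" "j \<noteq> j'" for j j'
  proof -
    have "j - 1 \<in> {..n}" "j' - 1 \<in> {..n}" "j - 1 \<noteq> j' - 1" using that \<open>p \<le> Suc n\<close> by auto
    then have "s j \<noteq> s j'"
      using X(2)[of "q r0"] by (auto simp: s_def T_def inj_on_def)
    then show ?thesis by (auto simp: different_def)
  qed
  ultimately show ?thesis using x(1) by blast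
qed

end
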